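(* Let $R$, $b$, $\Sigma$, $\gamma$, $\gamma_j$ and the class $\mathcal{C}$ be as in the context. Assume that $\psi\in\mathcal{C}$ and $\{\psi_j,\ j\in\mathcal{J}\}\subset\mathcal{C}$ satisfy $$\gamma(\theta)\psi(\theta)+\sum_{j\in\mathcal{J}}b_j\gamma_j(\theta)\psi_j(\theta)=0\qquad\text{for all }\theta\in\mathbb{R}^d\text{ with }\theta\le0,$$ and that, for each $j\in\mathcal{J}$, $\psi_j(\theta)$ does not depend on $\theta_j$. Then for any $A\subset\mathcal{J}$, $$\psi(0_A-)\ \ge\ \psi_j(0_A-),\qquad j\in\mathcal{J}.$$ Furthermore, when $A=\mathcal{J}$, $$\psi(0_{\mathcal{J}}-)=\psi_j(0_{\mathcal{J}}-),\qquad j\in\mathcal{J}.$$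
   Context: Inequalities between vectors are componentwise. Let $d\ge1$ and $\mathcal{J}=\{1,\dots,d\}$. Class $\mathcal{C}$: functions $f:\{\theta\in\mathbb{R}^d:\theta\le0\}\to[0,1]$ such that $f$ is continuous on $\{\theta\in\mathbb{R}^d:\theta<0\}$; $\theta_1\le\theta_2$ implies $f(\theta_1)\le f(\theta_2)$; and $f(0)=1$. Directional limits: for $A\subset\mathcal{J}$, a direction vector $c_A=(c_1,\dots,c_d)^T$ has $c_i=0$ for $i\notin A$, and $c_A>0$ means $c_i>0$ for all $i\in A$. For $f\in\mathcal{C}$, $f(0_A-):=\lim_{\alpha\uparrow0}f(\alpha c_A)$ for any direction vector $c_A>0$; the limit exists and does not depend on the choice of $c_A>0$. Data: $P=(p_{ij})_{i,j\in\mathcal{J}}$ is a nonnegative matrix with row sums at most $1$ such that $I-P$ is invertible with $(I-P)^{-1}=\sum_{k\ge0}P^k$; $R=I-P^T$ (transpose), with $j$th column $R^{(j)}$; $b\in\mathbb{R}^d$ has all components positive. With constants $\lambda_{e,i}\ge0$, $\sigma_{e,i}\ge0$, $\sigma_{s,i}\ge0$ and $\lambda_s=(I-P^T)^{-1}\lambda_e$, the symmetric matrix $\Sigma$ is given by ($\delta_{ij}$ the Kronecker delta) $$\Sigma_{ij}=\sum_{k\in\mathcal{J}}\lambda_{s,k}\big[p_{ki}(\delta_{ij}-p_{kj})+\lambda_{s,k}^2\sigma_{s,k}^2(p_{ki}-\delta_{ki})(p_{kj}-\delta_{kj})\big]+\lambda_{e,i}^3\sigma_{e,i}^2\delta_{ij},$$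 and is assumed positive definite. Finally $$\gamma(\theta)=\tfrac12\langle\theta,\Sigma\theta\rangle-\langle Rb,\theta\rangle,\qquad\gamma_j(\theta)=\langle R^{(j)},\theta\rangle,\qquad\theta\in\mathbb{R}^d,\ j\in\mathcal{J}.$$ *)

theory Defs
  imports "HOL-Analysis.Analysis"
begin

text \<open>
  The index set \<open>\<J>\<close> is the finite type \<open>'n\<close>, so \<open>d = CARD('n) \<ge> 1\<close>. The order \<open>\<le>\<close> on
  \<open>real^'n\<close> is the componentwise one of the library. Members of the class \<open>\<C>\<close> are total functions
  whose values outside the domain \<open>{\<theta>. \<theta> \<le> 0}\<close> are irrelevant.
\<close>

definition classC :: "(real^'n \<Rightarrow> real) set" where
  "classC = {f.
     (\<forall>\<theta>\<le>0. 0 \<le> f \<theta> \<and> f \<theta> \<le> 1) \<and>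
     continuous_on {\<theta>. \<forall>i. \<theta> $ i < 0} f \<and>
     (\<forall>\<theta>\<^sub>1 \<theta>\<^sub>2. \<theta>\<^sub>1 \<le> 0 \<longrightarrow> \<theta>\<^sub>2 \<le> 0 \<longrightarrow> \<theta>\<^sub>1 \<le> \<theta>\<^sub>2 \<longrightarrow> f \<theta>\<^sub>1 \<le> f \<theta>\<^sub>2) \<and>
     f 0 = 1}"

definition pos_direction :: "'n set \<Rightarrow> real^'n \<Rightarrow> bool" where
  "pos_direction A c \<longleftrightarrow> (\<forall>i\<in>A. c $ i > 0) \<and> (\<forall>i. i \<notin> A \<longrightarrow> c $ i = 0)"

text \<open>
  \<open>dirlim f A\<close> is \<open>f(0\<^sub>A-)\<close>: the common limit along all directions \<open>c\<^sub>A > 0\<close>. It is well defined on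
  \<open>classC\<close>; see \<open>dirlim_tendsto\<close> below.
\<close>

definition dirlim :: "(real^'n \<Rightarrow> real) \<Rightarrow> 'n set \<Rightarrow> real" where
  "dirlim f A =
     (THE L. \<forall>c. pos_direction A c \<longrightarrow> ((\<lambda>\<alpha>. f (\<alpha> *\<^sub>R c)) \<longlongrightarrow> L) (at_left 0))"

text \<open>
  The library power \<open>^\<close> on \<open>real^'n^'n\<close> is entrywise, hence a separate power for \<open>**\<close>.
\<close>

primrec matpow :: "real^'n^'n \<Rightarrow> nat \<Rightarrow> real^'n^'n" where
  "matpow P 0 = mat 1"
| "matpow P (Suc k) = P ** matpow P k"

definition reflection_matrix :: "real^'n^'n \<Rightarrow> real^'n^'n" where
  "reflection_matrix P = mat 1 - transpose P"

definition lambda_s :: "real^'n^'n \<Rightarrow> real^'n \<Rightarrow> real^'n" where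
  "lambda_s P lam\<^sub>e = matrix_inv (mat 1 - transpose P) *v lam\<^sub>e"

definition kdelta :: "'n \<Rightarrow> 'n \<Rightarrow> real" where
  "kdelta i j = (if i = j then 1 else 0)"

definition Sigma_matrix ::
  "real^'n^'n \<Rightarrow> real^'n \<Rightarrow> real^'n \<Rightarrow> real^'n \<Rightarrow> real^'n^'n" where
  "Sigma_matrix P lam\<^sub>e \<sigma>\<^sub>e \<sigma>\<^sub>s = (\<chi> i j.
     (\<Sum>k\<in>UNIV. lambda_s P lam\<^sub>e $ k *
        (P $ k $ i * (kdelta i j - P $ k $ j)
         + (lambda_s P lam\<^sub>e $ k)\<^sup>2 * (\<sigma>\<^sub>s $ k)\<^sup>2
           * (P $ k $ i - kdelta k i) * (P $ k $ j - kdelta k j)))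
     + (lam\<^sub>e $ i) ^ 3 * (\<sigma>\<^sub>e $ i)\<^sup>2 * kdelta i j)"

definition positive_definite :: "real^'n^'n \<Rightarrow> bool" where
  "positive_definite M \<longleftrightarrow> transpose M = M \<and> (\<forall>x. x \<noteq> 0 \<longrightarrow> x \<bullet> (M *v x) > 0)"

definition gamma_quad :: "real^'n^'n \<Rightarrow> real^'n^'n \<Rightarrow> real^'n \<Rightarrow> real^'n \<Rightarrow> real" where
  "gamma_quad S R b \<theta> = 1 / 2 * (\<theta> \<bullet> (S *v \<theta>)) - (R *v b) \<bullet> \<theta>"

definition gamma_lin :: "real^'n^'n \<Rightarrow> 'n \<Rightarrow> real^'n \<Rightarrow> real" where
  "gamma_lin R j \<theta> = column j R \<bullet> \<theta>"

lemma transpose_Sigma_matrix: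
  "transpose (Sigma_matrix P lam\<^sub>e \<sigma>\<^sub>e \<sigma>\<^sub>s) = Sigma_matrix P lam\<^sub>e \<sigma>\<^sub>e \<sigma>\<^sub>s"
  unfolding vec_eq_iff transpose_def Sigma_matrix_def
  by (auto simp: kdelta_def algebra_simps)

lemma classC_limit_ex:
  fixes f :: "real^'n \<Rightarrow> real"
  assumes f: "f \<in> classC" and c: "pos_direction A c"
  shows "((\<lambda>\<alpha>. f (\<alpha> *\<^sub>R c)) \<longlongrightarrow> (SUP \<alpha>\<in>{..<0}. f (\<alpha> *\<^sub>R c))) (at_left 0)"
proof -
  have c0: "c $ i \<ge> 0" for i
    using c unfolding pos_direction_def by (cases "i \<in> A") (auto intro: less_imp_le)
  have le0: "\<alpha> *\<^sub>R c \<le> 0" if "\<alpha> < 0" for \<alpha>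
    using c0 that by (auto simp: less_eq_vec_def mult_nonpos_nonneg)
  have mono: "f (\<alpha> *\<^sub>R c) \<le> f (\<beta> *\<^sub>R c)" if "\<alpha> \<le> \<beta>" "\<beta> < 0" for \<alpha> \<beta>
  proof -
    have "\<alpha> *\<^sub>R c \<le> \<beta> *\<^sub>R c"
      using c0 that by (auto simp: less_eq_vec_def mult_right_mono)
    thus ?thesis using f le0 that unfolding classC_def by auto
  qed
  have bdd: "bdd_above ((\<lambda>\<alpha>. f (\<alpha> *\<^sub>R c)) ` {..<0})"
    using f le0 unfolding classC_def by (intro bdd_aboveI[of _ 1]) auto
  show ?thesis
  proof (rule increasing_tendsto)
    show "\<forall>\<^sub>F \<alpha> in at_left 0. f (\<alpha> *\<^sub>R c) \<le> (SUP \<alpha>\<in>{..<0}. f (\<alpha> *\<^sub>R c))"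
      unfolding eventually_at_filter
      by (rule always_eventually) (use bdd in \<open>auto intro!: cSUP_upper\<close>)
  next
    fix x assume "x < (SUP \<alpha>\<in>{..<0}. f (\<alpha> *\<^sub>R c))"
    then obtain \<beta> where b: "\<beta> < 0" "x < f (\<beta> *\<^sub>R c)"
      using less_cSUP_iff[OF _ bdd, of x] lt_ex[of "0::real"] by auto
    have "\<forall>\<^sub>F \<alpha> in at_left 0. \<beta> < \<alpha> \<and> \<alpha> < 0"
      using eventually_at_left_real[OF b(1)] by simp
    thus "\<forall>\<^sub>F \<alpha> in at_left 0. x < f (\<alpha> *\<^sub>R c)"
    proof eventually_elim
      case (elim \<alpha>)
      have "f (\<beta> *\<^sub>R c) \<le> f (\<alpha> *\<^sub>R c)" by (rule mono) (use elim in auto)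
      with b(2) show ?case by (rule less_le_trans)
    qed
  qed
qed

lemma classC_SUP_le:
  fixes f :: "real^'n \<Rightarrow> real"
  assumes f: "f \<in> classC" and c: "pos_direction A c" and c': "pos_direction A c'"
  shows "(SUP \<alpha>\<in>{..<0}. f (\<alpha> *\<^sub>R c)) \<le> (SUP \<alpha>\<in>{..<0}. f (\<alpha> *\<^sub>R c'))"
proof (rule cSUP_mono)
  have c0: "c $ i \<ge> 0" "c' $ i \<ge> 0" for i
    using c c' unfolding pos_direction_def by (cases "i \<in> A"; auto intro: less_imp_le)+
  have le0: "\<alpha> *\<^sub>R c \<le> 0" "\<alpha> *\<^sub>R c' \<le> 0" if "\<alpha> < 0" for \<alpha>
    using c0 that by (auto simp: less_eq_vec_def mult_nonpos_nonneg)
  show "bdd_above ((\<lambda>\<alpha>. f (\<alpha> *\<^sub>R c')) ` {..<0})"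
    using f le0 unfolding classC_def by (intro bdd_aboveI[of _ 1]) auto
  show "{..<0::real} \<noteq> {}" using lt_ex by blast
  fix \<alpha> :: real assume "\<alpha> \<in> {..<0}"
  hence a: "\<alpha> < 0" by simp
  obtain k where k: "k > 0" "\<And>i. k * c' $ i \<le> c $ i"
  proof
    define k where "k = Min (insert 1 ((\<lambda>i. c $ i / c' $ i) ` A))"
    show "k > 0" unfolding k_def using c c' by (auto simp: pos_direction_def)
    show "k * c' $ i \<le> c $ i" for i
    proof (cases "i \<in> A")
      case True
      have "k \<le> c $ i / c' $ i" unfolding k_def using True by (intro Min_le) auto
      thus ?thesis using c' True by (auto simp: pos_direction_def field_simps)
    qed (use c c' in \<open>auto simp: pos_direction_def\<close>)
  qed
  have ak: "\<alpha> * k < 0" using a k by (simp add: mult_neg_pos)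
  have "\<alpha> *\<^sub>R c \<le> (\<alpha> * k) *\<^sub>R c'"
    using a k(2) by (auto simp: less_eq_vec_def mult.assoc mult_left_mono_neg)
  hence "f (\<alpha> *\<^sub>R c) \<le> f ((\<alpha> * k) *\<^sub>R c')"
    using f le0[OF a] le0[OF ak] unfolding classC_def by blast
  thus "\<exists>\<beta>\<in>{..<0}. f (\<alpha> *\<^sub>R c) \<le> f (\<beta> *\<^sub>R c')" using ak by auto
qed

lemma dirlim_tendsto:
  fixes f :: "real^'n \<Rightarrow> real"
  assumes f: "f \<in> classC" and c: "pos_direction A c"
  shows "((\<lambda>\<alpha>. f (\<alpha> *\<^sub>R c)) \<longlongrightarrow> dirlim f A) (at_left 0)"
proof -
  let ?L = "SUP \<alpha>\<in>{..<0}. f (\<alpha> *\<^sub>R c)"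
  have lim: "((\<lambda>\<alpha>. f (\<alpha> *\<^sub>R c')) \<longlongrightarrow> ?L) (at_left 0)" if "pos_direction A c'" for c'
    using classC_limit_ex[OF f that] classC_SUP_le[OF f that c] classC_SUP_le[OF f c that]
    by simp
  have "dirlim f A = ?L"
    unfolding dirlim_def
    by (rule the_equality)
      (use lim c in \<open>auto intro: tendsto_unique[OF trivial_limit_at_left_real]\<close>)
  thus ?thesis using lim[OF c] by simp
qed

end

(*
  Since <R b, \<theta>> = \<Sum>j. b_j \<gamma>_j(\<theta>), the hypothesis says
  <\<theta>, \<Sigma> \<theta>> \<psi>(\<theta>) / 2 = \<Sum>j. b_j \<gamma>_j(\<theta>) (\<psi>(\<theta>) - \<psi>_j(\<theta>)).
  Put \<theta> = \<alpha> c with c a direction for A, divide by \<alpha> and let \<alpha> increase to 0: the vector x with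
  x_j = b_j (\<psi>(0_A-) - \<psi>_j(0_A-)) satisfies (R x)_i = 0 for i in A. As P has spectral radius below 1,
  x is nonnegative once x_j \<ge> 0 for all j outside A. The latter follows by downward induction
  on A: \<psi>(0_A-) \<ge> \<psi>(0_B-) \<ge> \<psi>_j(0_B-) = \<psi>_j(0_A-) for B = A \<union> {j}, where the equality holds
  because \<psi>_j does not depend on \<theta>_j. For A the whole index set, R x = 0 also gives -x \<ge> 0.
*)
theory Submission
  imports Defs
begin

lemma vector_matrix_mult_mono:
  fixes M :: "real^'n^'m"
  assumes "v \<le> w" "\<And>i j. M $ i $ j \<ge> 0"
  shows "v v* M \<le> w v* M"
  using assms by (auto simp: less_eq_vec_def vector_matrix_mult_def intro!: sum_mono mult_right_mono)

lemma matpow_nonneg: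
  assumes "\<And>i j. P $ i $ j \<ge> 0"
  shows "matpow P k $ i $ j \<ge> 0"
  by (induction k arbitrary: i j)
    (auto simp: mat_def matrix_matrix_mult_def assms intro!: sum_nonneg)

text \<open>Iterating the hypothesis gives \<open>y \<le> y v* matpow P k\<close> for every k, and
  the right side tends to 0.\<close>

lemma le_vector_matrix_mult_imp_nonpos:
  fixes P :: "real^'n^'n"
  assumes P: "\<And>i j. P $ i $ j \<ge> 0"
    and lim: "matpow P \<longlonglongrightarrow> 0"
    and y: "y \<le> y v* P"
  shows "y \<le> 0"
proof -
  have le: "y \<le> y v* matpow P k" for k
  proof (induction k)
    case (Suc k)
    \<comment> \<open>Multiplying by the nonnegative matrix \<open>matpow P k\<close> on the right
      preserves \<open>y \<le> y v* P\<close>; associativity then yields the next power.\<close>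
    also have "y v* matpow P k \<le> (y v* P) v* matpow P k"
      by (intro vector_matrix_mult_mono y matpow_nonneg P)
    finally show ?case by (simp add: vector_matrix_mul_assoc)
  qed simp
  show ?thesis
  proof (unfold less_eq_vec_def, intro allI)
    fix i
    have "(\<lambda>k. \<Sum>j\<in>UNIV. y $ j * matpow P k $ j $ i) \<longlonglongrightarrow> (\<Sum>j\<in>UNIV. y $ j * 0 $ j $ i)"
      by (intro tendsto_sum tendsto_mult tendsto_vec_nth lim tendsto_const)
    moreover have "y $ i \<le> (\<Sum>j\<in>UNIV. y $ j * matpow P k $ j $ i)" for k
      using le[of k] by (simp add: less_eq_vec_def vector_matrix_mult_def)
    ultimately show "y $ i \<le> 0 $ i"
      using LIMSEQ_le_const by fastforce
  qed
qed

lemma reflection_matrix_mult: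
  "(reflection_matrix P *v x) $ i = x $ i - (\<Sum>j\<in>UNIV. x $ j * P $ j $ i)"
  by (simp add: reflection_matrix_def matrix_vector_mult_diff_rdistrib)
    (simp add: vector_matrix_mult_def)

text \<open>A minimum principle: the negative part y of x satisfies \<open>y \<le> y v* P\<close>,
  so it vanishes by the previous iteration argument.\<close>

lemma reflection_matrix_mult_nonneg_imp_nonneg:
  fixes P :: "real^'n^'n"
  assumes P: "\<And>i j. P $ i $ j \<ge> 0"
    and lim: "matpow P \<longlonglongrightarrow> 0"
    and inside: "\<And>i. i \<in> A \<Longrightarrow> (reflection_matrix P *v x) $ i \<ge> 0"
    and outside: "\<And>i. i \<notin> A \<Longrightarrow> x $ i \<ge> 0"
  shows "x $ i \<ge> 0"
proof -
  define y where "y = (\<chi> i. max (- x $ i) 0)"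
  have "y $ i \<le> (\<Sum>j\<in>UNIV. y $ j * P $ j $ i)" for i
  proof (cases "x $ i \<ge> 0")
    case True
    then show ?thesis by (auto simp: y_def P intro!: sum_nonneg)
  next
    case False
    then have "y $ i = - x $ i" by (simp add: y_def)
    \<comment> \<open>Since x is negative at i, \<open>outside\<close> forces
      \<open>i \<in> A\<close>, and there \<open>inside\<close> is exactly this inequality.\<close>
    also have "\<dots> \<le> (\<Sum>j\<in>UNIV. (- x $ j) * P $ j $ i)"
      using inside[of i] outside[of i] False by (auto simp: reflection_matrix_mult sum_negf)
    also have "\<dots> \<le> (\<Sum>j\<in>UNIV. y $ j * P $ j $ i)"
      by (intro sum_mono mult_right_mono P) (simp add: y_def)
    finally show ?thesis .
  qed
  then have "y \<le> 0"
    by (intro le_vector_matrix_mult_imp_nonpos[OF P lim])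
      (simp add: less_eq_vec_def vector_matrix_mult_def)
  then have "y $ i \<le> 0" by (simp add: less_eq_vec_def)
  then show ?thesis by (simp add: y_def)
qed

lemma pos_direction_nonneg: "pos_direction A c \<Longrightarrow> c $ i \<ge> 0"
  unfolding pos_direction_def by (metis less_imp_le order_refl)

lemma pos_direction_scaleR_nonpos:
  fixes c :: "real^'n"
  shows "pos_direction A c \<Longrightarrow> \<alpha> < 0 \<Longrightarrow> \<alpha> *\<^sub>R c \<le> 0"
  using pos_direction_nonneg by (auto simp: less_eq_vec_def intro!: mult_nonpos_nonneg)

lemma pos_direction_indicator: "pos_direction A (\<chi> i. if i \<in> A then 1 else 0)"
  by (simp add: pos_direction_def)

text \<open>Raising one coordinate of the indicator of A within A gives another direction for A;
  subtracting the two orthogonality relations isolates \<open>v $ i\<close>.\<close>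

lemma orthogonal_pos_direction_imp_zero:
  fixes v :: "real^'n"
  assumes orth: "\<And>c. pos_direction A c \<Longrightarrow> v \<bullet> c = 0" and "i \<in> A"
  shows "v $ i = 0"
proof -
  let ?c = "\<chi> i. if i \<in> A then 1 else (0::real)"
  have "pos_direction A (?c + axis i 1)"
    using \<open>i \<in> A\<close> by (auto simp: pos_direction_def axis_def)
  from orth[OF this] orth[OF pos_direction_indicator[of A]] show ?thesis
    by (simp add: inner_add_right inner_axis)
qed

text \<open>For negative \<alpha>, enlarging the index set pushes further coordinates of the point
  from 0 down to \<alpha>, and f is monotone.\<close>

lemma dirlim_antimono:
  fixes f :: "real^'n \<Rightarrow> real"
  assumes f: "f \<in> classC" and "A \<subseteq> B"
  shows "dirlim f B \<le> dirlim f A"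
proof -
  let ?c = "\<lambda>A. \<chi> i. if i \<in> A then 1 else (0::real)"
  have le: "f (\<alpha> *\<^sub>R ?c B) \<le> f (\<alpha> *\<^sub>R ?c A)" if "\<alpha> < 0" for \<alpha>
  proof -
    have "\<alpha> *\<^sub>R ?c B \<le> \<alpha> *\<^sub>R ?c A"
      using that \<open>A \<subseteq> B\<close> by (auto simp: less_eq_vec_def)
    with f that show ?thesis
      using pos_direction_scaleR_nonpos[OF pos_direction_indicator] unfolding classC_def by blast
  qed
  show ?thesis
    by (rule tendsto_le[OF trivial_limit_at_left_real
          dirlim_tendsto[OF f pos_direction_indicator] dirlim_tendsto[OF f pos_direction_indicator]])
      (auto simp: eventually_at_filter le)
qed

text \<open>The indicators of \<open>insert j A\<close> and A differ at most in coordinate j, so f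
  takes the same values along both rays.\<close>

lemma dirlim_insert_indep:
  fixes f :: "real^'n \<Rightarrow> real"
  assumes f: "f \<in> classC"
    and indep: "\<And>\<theta> \<theta>'. \<theta> \<le> 0 \<Longrightarrow> \<theta>' \<le> 0 \<Longrightarrow> (\<And>i. i \<noteq> j \<Longrightarrow> \<theta> $ i = \<theta>' $ i) \<Longrightarrow> f \<theta> = f \<theta>'"
  shows "dirlim f (insert j A) = dirlim f A"
proof -
  let ?c = "\<lambda>A. \<chi> i. if i \<in> A then 1 else (0::real)"
  have "f (\<alpha> *\<^sub>R ?c (insert j A)) = f (\<alpha> *\<^sub>R ?c A)" if "\<alpha> < 0" for \<alpha>
    by (intro indep pos_direction_scaleR_nonpos[OF pos_direction_indicator that]) simp
  then have "((\<lambda>\<alpha>. f (\<alpha> *\<^sub>R ?c A)) \<longlongrightarrow> dirlim f (insert j A)) (at_left 0)"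
    by (intro Lim_transform_eventually[OF dirlim_tendsto[OF f pos_direction_indicator]])
      (auto simp: eventually_at_filter)
  then show ?thesis
    using dirlim_tendsto[OF f pos_direction_indicator] tendsto_unique[OF trivial_limit_at_left_real]
    by blast
qed

text \<open>The product \<open>R *v b\<close> combines the columns of R. This serves twice: for b it
  merges the drift of \<open>gamma_quad\<close> with the boundary terms, and for the vector of
  weighted limit differences it turns the limiting sum into an inner product.\<close>

lemma matrix_mult_inner_eq_gamma_lin:
  "(R *v b) \<bullet> \<theta> = (\<Sum>j\<in>UNIV. b $ j * gamma_lin R j \<theta>)"
  by (simp add: matrix_mult_sum gamma_lin_def inner_sum_left scalar_mult_eq_scaleR)

text \<open>The limits do not depend on the direction c, so one vector is orthogonal to every
  direction for A, and its components in A vanish.\<close>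

lemma basic_adjoint_relation_dirlim:
  fixes R \<Sigma> :: "real^'n^'n" and \<psi> :: "real^'n \<Rightarrow> real"
  assumes psi: "\<psi> \<in> classC" and psij: "\<And>j. \<psi>j j \<in> classC"
    and BAR: "\<And>\<theta>. \<theta> \<le> 0 \<Longrightarrow>
        gamma_quad \<Sigma> R b \<theta> * \<psi> \<theta> + (\<Sum>j\<in>UNIV. b $ j * gamma_lin R j \<theta> * \<psi>j j \<theta>) = 0"
    and "i \<in> A"
  shows "(R *v (\<chi> j. b $ j * (dirlim \<psi> A - dirlim (\<psi>j j) A))) $ i = 0"
proof (rule orthogonal_pos_direction_imp_zero[OF _ \<open>i \<in> A\<close>])
  fix c :: "real^'n" assume c: "pos_direction A c"
  let ?S = "\<lambda>\<alpha>. \<Sum>j\<in>UNIV. b $ j * (\<psi> (\<alpha> *\<^sub>R c) - \<psi>j j (\<alpha> *\<^sub>R c)) * gamma_lin R j c"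
  have S: "\<alpha> * (1 / 2 * (c \<bullet> (\<Sigma> *v c)) * \<psi> (\<alpha> *\<^sub>R c)) = ?S \<alpha>" if "\<alpha> < 0" for \<alpha>
  proof -
    have "gamma_lin R j (\<alpha> *\<^sub>R c) = \<alpha> * gamma_lin R j c" for j
      by (simp add: gamma_lin_def)
    then have quad: "gamma_quad \<Sigma> R b (\<alpha> *\<^sub>R c) = \<alpha> * (\<alpha> * (1 / 2 * (c \<bullet> (\<Sigma> *v c))))
        - \<alpha> * (\<Sum>j\<in>UNIV. b $ j * gamma_lin R j c)"
      by (simp add: gamma_quad_def matrix_mult_inner_eq_gamma_lin[symmetric]
          matrix_vector_mult_scaleR)
    have lin: "(\<Sum>j\<in>UNIV. b $ j * gamma_lin R j (\<alpha> *\<^sub>R c) * \<psi>j j (\<alpha> *\<^sub>R c))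
        = \<alpha> * (\<Sum>j\<in>UNIV. b $ j * gamma_lin R j c * \<psi>j j (\<alpha> *\<^sub>R c))"
      by (simp add: gamma_lin_def sum_distrib_left mult_ac)
    have diff: "?S \<alpha> = (\<Sum>j\<in>UNIV. b $ j * gamma_lin R j c) * \<psi> (\<alpha> *\<^sub>R c)
        - (\<Sum>j\<in>UNIV. b $ j * gamma_lin R j c * \<psi>j j (\<alpha> *\<^sub>R c))"
      unfolding sum_distrib_right sum_subtractf[symmetric]
      by (intro sum.cong) (simp_all add: algebra_simps)
    \<comment> \<open>Along the ray the quadratic term carries two factors \<alpha> and the linear
      terms one. Cancelling one leaves a factor that removes the quadratic term in the
      limit.\<close>
    have "\<alpha> * (\<alpha> * (1 / 2 * (c \<bullet> (\<Sigma> *v c)) * \<psi> (\<alpha> *\<^sub>R c))) = \<alpha> * ?S \<alpha>"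
      using BAR[OF pos_direction_scaleR_nonpos[OF c that]] unfolding quad lin diff
      by (simp only: left_diff_distrib right_diff_distrib mult.assoc)
    from mult_left_cancel[THEN iffD1, OF _ this] that show ?thesis by blast
  qed
  have "((\<lambda>\<alpha>. \<alpha> * (1 / 2 * (c \<bullet> (\<Sigma> *v c)) * \<psi> (\<alpha> *\<^sub>R c)))
      \<longlongrightarrow> 0 * (1 / 2 * (c \<bullet> (\<Sigma> *v c)) * dirlim \<psi> A)) (at_left 0)"
    by (intro tendsto_mult tendsto_const tendsto_ident_at dirlim_tendsto psi c)
  then have "(?S \<longlongrightarrow> 0) (at_left 0)"
    by (rule Lim_transform_eventually[OF tendsto_eq_rhs])
      (simp, unfold eventually_at_filter, intro always_eventually allI impI S, simp)
  moreover have "(?S \<longlongrightarrow> (\<Sum>j\<in>UNIV. b $ j * (dirlim \<psi> A - dirlim (\<psi>j j) A) * gamma_lin R j c))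
      (at_left 0)"
    by (intro tendsto_sum tendsto_mult tendsto_diff tendsto_const dirlim_tendsto psi psij c)
  ultimately show "(R *v (\<chi> j. b $ j * (dirlim \<psi> A - dirlim (\<psi>j j) A))) \<bullet> c = 0"
    unfolding matrix_mult_inner_eq_gamma_lin
    by (simp add: tendsto_unique[OF trivial_limit_at_left_real])
qed

theorem proposition5p1:
  fixes P R \<Sigma> :: "real^'n^'n"
    and b lam\<^sub>e \<sigma>\<^sub>e \<sigma>\<^sub>s :: "real^'n"
    and \<psi> :: "real^'n \<Rightarrow> real"
    and \<psi>j :: "'n \<Rightarrow> real^'n \<Rightarrow> real"
  assumes P_nonneg: "\<And>i j. P $ i $ j \<ge> 0"
    and P_rowsum: "\<And>i. (\<Sum>j\<in>UNIV. P $ i $ j) \<le> 1"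
    and P_invertible: "invertible (mat 1 - P)"
    and P_neumann: "(\<lambda>k. matpow P k) sums matrix_inv (mat 1 - P)"
    and R_eq: "R = reflection_matrix P"
    and b_pos: "\<And>i. b $ i > 0"
    and lambda_e_nonneg: "\<And>i. lam\<^sub>e $ i \<ge> 0"
    and sigma_e_nonneg: "\<And>i. \<sigma>\<^sub>e $ i \<ge> 0"
    and sigma_s_nonneg: "\<And>i. \<sigma>\<^sub>s $ i \<ge> 0"
    and Sigma_eq: "\<Sigma> = Sigma_matrix P lam\<^sub>e \<sigma>\<^sub>e \<sigma>\<^sub>s"
    and Sigma_pd: "positive_definite \<Sigma>"
    and psi_C: "\<psi> \<in> classC"
    and psij_C: "\<And>j. \<psi>j j \<in> classC"
    and BAR: "\<And>\<theta>. \<theta> \<le> 0 \<Longrightarrow>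
        gamma_quad \<Sigma> R b \<theta> * \<psi> \<theta> + (\<Sum>j\<in>UNIV. b $ j * gamma_lin R j \<theta> * \<psi>j j \<theta>) = 0"
    and psij_indep: "\<And>j \<theta> \<theta>'. \<theta> \<le> 0 \<Longrightarrow> \<theta>' \<le> 0 \<Longrightarrow> (\<And>i. i \<noteq> j \<Longrightarrow> \<theta> $ i = \<theta>' $ i)
        \<Longrightarrow> \<psi>j j \<theta> = \<psi>j j \<theta>'"
  shows "(\<forall>A j. dirlim \<psi> A \<ge> dirlim (\<psi>j j) A) \<and>
         (\<forall>j. dirlim \<psi> UNIV = dirlim (\<psi>j j) UNIV)"
proof (intro conjI allI)
  define x where "x A = (\<chi> j. b $ j * (dirlim \<psi> A - dirlim (\<psi>j j) A))" for A
  have x_nonneg_iff: "x A $ j \<ge> 0 \<longleftrightarrow> dirlim (\<psi>j j) A \<le> dirlim \<psi> A" for A j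
    using b_pos[of j] by (simp add: x_def zero_le_mult_iff)
  \<comment> \<open>The terms of the convergent Neumann series tend to 0.\<close>
  have lim: "matpow P \<longlonglongrightarrow> 0"
    using P_neumann by (intro summable_LIMSEQ_zero) (rule sums_summable)
  have Rx: "(reflection_matrix P *v x A) $ i = 0" if "i \<in> A" for A i
    using basic_adjoint_relation_dirlim[OF psi_C psij_C BAR that] by (simp add: x_def R_eq)
  show le: "dirlim (\<psi>j j) A \<le> dirlim \<psi> A" for A j
  \<comment> \<open>The induction is on the size of the complement, so larger index sets come first;
    for \<open>A = UNIV\<close> the condition \<open>outside\<close> is vacuous.\<close>
  proof (induction "card (- A)" arbitrary: A j rule: less_induct)
    case less
    have outside: "x A $ i \<ge> 0" if "i \<notin> A" for i
    proof -
      have "card (- insert i A) < card (- A)"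
        using that by (intro psubset_card_mono) auto
      then have "dirlim (\<psi>j i) (insert i A) \<le> dirlim \<psi> (insert i A)"
        by (rule less)
      also have "\<dots> \<le> dirlim \<psi> A"
        by (rule dirlim_antimono[OF psi_C]) auto
      also have "dirlim (\<psi>j i) (insert i A) = dirlim (\<psi>j i) A"
        by (rule dirlim_insert_indep[OF psij_C psij_indep])
      finally show ?thesis by (simp add: x_nonneg_iff)
    qed
    have "x A $ j \<ge> 0"
      by (rule reflection_matrix_mult_nonneg_imp_nonneg[OF P_nonneg lim _ outside])
        (simp_all add: Rx)
    then show ?case by (simp add: x_nonneg_iff)
  qed
  fix j
  \<comment> \<open>With no index outside \<open>UNIV\<close>, \<open>Rx\<close> gives the whole
    equation R x = 0, which is invariant under a change of sign; the minimum principle thus applies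
    to -x as well.\<close>
  have "(- x UNIV) $ j \<ge> 0"
  proof (rule reflection_matrix_mult_nonneg_imp_nonneg[OF P_nonneg lim, where A = UNIV])
    fix i
    have "reflection_matrix P *v (- x UNIV) = - (reflection_matrix P *v x UNIV)"
      by (simp add: vec_eq_iff matrix_vector_mult_def sum_negf)
    then show "(reflection_matrix P *v (- x UNIV)) $ i \<ge> 0" by (simp add: Rx)
  qed simp
  then have "dirlim \<psi> UNIV \<le> dirlim (\<psi>j j) UNIV"
    using b_pos[of j] by (simp add: x_def mult_le_0_iff)
  with le show "dirlim \<psi> UNIV = dirlim (\<psi>j j) UNIV" by (simp add: antisym)
qed

end
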